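(* Suppose the reward distributions $f_1,\dots,f_N$ are all light-tailed. Let $\zeta>0$, $u_0>0$ and $a\in(0,\frac{1}{2\zeta}]$ be constants such that for every arm $n$, every integer $s\ge 1$ and every $\delta'\in[0,\zeta u_0]$, $$\Pr\left(\left|\frac1s\sum_{t=1}^s X_n(t)-\theta_n\right|\ge\delta'\right)\le 2\exp(-a\delta'^2 s).$$ Choose a constant $c\in(0,\Delta_2)$, let $\delta=\min\{c/2,\zeta u_0\}$, and choose a constant $w>\frac{1}{a\delta^2}$. Construct the exploration sequence as follows: for each $t>1$, $t$ is included in $\mathcal A(t)$ if and only if $|\mathcal A(t-1)|<N\lceil w\log t\rceil$. Then the resulting DSEE policy $\pi^*$ satisfies, for all $T\ge1$, $$R_T^{\pi^*}(\mathcal F)\le\sum_{n=2}^N\lceil w\log T\rceil\,\Delta_n+2N\Delta_N\left(1+\frac{1}{a\delta^2w-1}\right).$$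
   Context: Bandit model: there are $N\ge2$ independent arms. Playing arm $n$ at time $t\in\{1,2,\dots\}$ yields a reward $X_n(t)$; for each $n$ the rewards $X_n(1),X_n(2),\dots$ are i.i.d. with unknown distribution $f_n$ and finite mean $\theta_n=\mathbb E[X_n(t)]$. Write $\mathcal F=(f_1,\dots,f_N)$. Let $\sigma$ be a permutation of $\{1,\dots,N\}$ with $\theta_{\sigma(1)}\ge\cdots\ge\theta_{\sigma(N)}$, and $\Delta_n=\theta_{\sigma(1)}-\theta_{\sigma(n)}$. At each time a single player plays one arm, chosen by a policy $\pi$ from past observations and decisions. The regret is $R_T^\pi(\mathcal F)=T\theta_{\sigma(1)}-\mathbb E_\pi[\sum_{t=1}^T X_\pi(t)]$, where $X_\pi(t)$ is the reward obtained at time $t$ under $\pi$. Light-tailed: a random variable $X$ is light-tailed if there is $u_0>0$ such that $\mathbb E[\exp(uX)]<\infty$ for all $|u|\le u_0$. DSEE policy: $\mathcal A(t)\subseteq\{1,\dots,t\}$ denotes the (deterministic) set of exploration times up to and including $t$, so $\mathcal A(t)$ equals $\mathcal A(t-1)$ or $\mathcal A(t-1)\cup\{t\}$, with $\mathcal A(0)=\mathcal A(1)=\emptyset$. For positive integers $k,l$ put $k\oslash l=((k-1)\bmod l)+1$. Let $\overline\theta_n(t)$ be the sample mean of arm $n$ computed from the observations of arm $n$ at times in $\mathcal A(t-1)$ (arbitrary if there are none). At time $t$: if $t\in\mathcal A(t)$, play arm $|\mathcal A(t)|\oslash N$; if $t\notin\mathcal A(t)$, play an arm maximizing $\overline\theta_n(t)$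 over $1\le n\le N$ (ties broken arbitrarily). $\log$ is the natural logarithm. *)

theory Defs
  imports "HOL-Probability.Probability"
begin

definition light_tailed :: "'a measure \<Rightarrow> ('a \<Rightarrow> real) \<Rightarrow> bool" where
  "light_tailed M X \<longleftrightarrow> (\<exists>u0>0. \<forall>u. \<bar>u\<bar> \<le> u0 \<longrightarrow> integrable M (\<lambda>\<omega>. exp (u * X \<omega>)))"

text \<open>
  Arms are numbered \<open>1, \<dots>, N\<close> and times \<open>1, 2, \<dots>\<close>; \<open>X n t\<close> is the reward that arm \<open>n\<close> yields
  if it is played at time \<open>t\<close>. The random variable \<open>U\<close> is a private source of randomness of the
  player, independent of all rewards, so that ties may also be broken at random; a policy that
  depends on past observations and decisions only is one that ignores \<open>U\<close>.
\<close>

locale bandit = prob_space M for M :: "'a measure" +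
  fixes N :: nat and f :: "nat \<Rightarrow> real measure"
    and X :: "nat \<Rightarrow> nat \<Rightarrow> 'a \<Rightarrow> real" and U :: "'a \<Rightarrow> real"
  assumes two_arms: "2 \<le> N"
    and indep: "indep_vars (\<lambda>_. borel) (\<lambda>i. case i of None \<Rightarrow> U | Some (n, t) \<Rightarrow> X n t)
                  (insert None (Some ` ({1..N} \<times> {1..})))"
    and distr: "\<And>n t. n \<in> {1..N} \<Longrightarrow> 1 \<le> t \<Longrightarrow> distr M borel (X n t) = f n"
    and finite_mean: "\<And>n. n \<in> {1..N} \<Longrightarrow> integrable (f n) (\<lambda>x. x)"

definition mean :: "(nat \<Rightarrow> real measure) \<Rightarrow> nat \<Rightarrow> real" where
  "mean f n = (\<integral>x. x \<partial>f n)"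

definition sorts_means :: "nat \<Rightarrow> (nat \<Rightarrow> real measure) \<Rightarrow> (nat \<Rightarrow> nat) \<Rightarrow> bool" where
  "sorts_means N f \<sigma> \<longleftrightarrow> \<sigma> permutes {1..N} \<and>
     (\<forall>i\<in>{1..N}. \<forall>j\<in>{1..N}. i \<le> j \<longrightarrow> mean f (\<sigma> j) \<le> mean f (\<sigma> i))"

definition gap :: "(nat \<Rightarrow> real measure) \<Rightarrow> (nat \<Rightarrow> nat) \<Rightarrow> nat \<Rightarrow> real" where
  "gap f \<sigma> n = mean f (\<sigma> 1) - mean f (\<sigma> n)"

text \<open>
  A history up to time \<open>t\<close> assigns to each \<open>s \<in> {1..t}\<close> the arm played at time \<open>s\<close> and the
  reward observed; \<open>\<pi> t u h\<close> is the arm that the policy plays at time \<open>t\<close> after the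
  history \<open>h\<close> up to time \<open>t - 1\<close>, where \<open>u\<close> is the value of the private randomness.
\<close>

type_synonym history = "nat \<Rightarrow> nat \<times> real"
type_synonym policy = "nat \<Rightarrow> real \<Rightarrow> history \<Rightarrow> nat"

definition history_space :: "nat \<Rightarrow> nat \<Rightarrow> history measure" where
  "history_space N t = (\<Pi>\<^sub>M s\<in>{1..t}. count_space {1..N} \<Otimes>\<^sub>M borel)"

definition is_policy :: "nat \<Rightarrow> policy \<Rightarrow> bool" where
  "is_policy N \<pi> \<longleftrightarrow> (\<forall>t\<ge>1. (\<lambda>(u, h). \<pi> t u h) \<in>
     borel \<Otimes>\<^sub>M history_space N (t - 1) \<rightarrow>\<^sub>M count_space {1..N})"

text \<open>
  The history produced when policy \<open>\<pi>\<close> faces the reward table \<open>x\<close> (\<open>x n t\<close> for arm \<open>n\<close> at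
  time \<open>t\<close>); only the entries of the arms actually played enter the history. It is left
  \<open>undefined\<close> outside \<open>{1..t}\<close>, as required of elements of \<open>history_space\<close>.
\<close>

primrec run :: "policy \<Rightarrow> real \<Rightarrow> (nat \<Rightarrow> nat \<Rightarrow> real) \<Rightarrow> nat \<Rightarrow> history" where
  "run \<pi> u x 0 = (\<lambda>_. undefined)"
| "run \<pi> u x (Suc t) = (run \<pi> u x t)(Suc t :=
     (let n = \<pi> (Suc t) u (run \<pi> u x t) in (n, x n (Suc t))))"

definition obtained_reward ::
    "(nat \<Rightarrow> nat \<Rightarrow> 'a \<Rightarrow> real) \<Rightarrow> ('a \<Rightarrow> real) \<Rightarrow> policy \<Rightarrow> nat \<Rightarrow> 'a \<Rightarrow> real" where
  "obtained_reward X U \<pi> t \<omega> = snd (run \<pi> (U \<omega>) (\<lambda>n s. X n s \<omega>) t t)"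

definition regret :: "'a measure \<Rightarrow> (nat \<Rightarrow> real measure) \<Rightarrow> (nat \<Rightarrow> nat \<Rightarrow> 'a \<Rightarrow> real) \<Rightarrow>
    ('a \<Rightarrow> real) \<Rightarrow> (nat \<Rightarrow> nat) \<Rightarrow> policy \<Rightarrow> nat \<Rightarrow> real" where
  "regret M f X U \<sigma> \<pi> T =
     real T * mean f (\<sigma> 1) - (\<integral>\<omega>. (\<Sum>t=1..T. obtained_reward X U \<pi> t \<omega>) \<partial>M)"

definition oslash :: "nat \<Rightarrow> nat \<Rightarrow> nat" (infixl "\<oslash>" 70) where
  "k \<oslash> l = ((k - 1) mod l) + 1"

definition exploration_sequence :: "(nat \<Rightarrow> nat set) \<Rightarrow> bool" where
  "exploration_sequence A \<longleftrightarrow> A 0 = {} \<and> A 1 = {} \<and>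
     (\<forall>t\<ge>1. A t = A (t - 1) \<or> A t = A (t - 1) \<union> {t})"

definition sample_times :: "(nat \<Rightarrow> nat set) \<Rightarrow> history \<Rightarrow> nat \<Rightarrow> nat \<Rightarrow> nat set" where
  "sample_times A h t n = {s \<in> A (t - 1). fst (h s) = n}"

definition sample_mean :: "(nat \<Rightarrow> nat set) \<Rightarrow> history \<Rightarrow> nat \<Rightarrow> nat \<Rightarrow> real" where
  "sample_mean A h t n =
     (\<Sum>s\<in>sample_times A h t n. snd (h s)) / real (card (sample_times A h t n))"

text \<open>
  The existentially quantified \<open>m\<close> leaves the sample mean of an arm without observations
  arbitrary, and only the maximality of the chosen arm is required, so ties are broken
  arbitrarily.
\<close>

definition dsee_policy :: "nat \<Rightarrow> (nat \<Rightarrow> nat set) \<Rightarrow> policy \<Rightarrow> bool" where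
  "dsee_policy N A \<pi> \<longleftrightarrow> is_policy N \<pi> \<and>
     (\<forall>t\<ge>1. \<forall>u. \<forall>h\<in>space (history_space N (t - 1)).
        if t \<in> A t then \<pi> t u h = card (A t) \<oslash> N
        else \<exists>m. (\<forall>n\<in>{1..N}. sample_times A h t n \<noteq> {} \<longrightarrow> m n = sample_mean A h t n) \<and>
                 (\<forall>n\<in>{1..N}. m n \<le> m (\<pi> t u h)))"

end

theory Submission
  imports Defs
begin

text \<open>
  The arm played at time \<open>t\<close> depends only on the private randomness and on earlier rewards, so it
  is independent of the rewards at time \<open>t\<close> and the regret is a sum over time of the expected loss in
  means. Exploration is deterministic and round-robin, with at most \<open>N \<lceil>w ln T\<rceil>\<close> exploration times up
  to \<open>T\<close>; these account for the logarithmic term. At an exploitation time \<open>t \<ge> 2\<close> every arm has been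
  sampled at least \<open>w ln t\<close> times, so by concentration and a union bound all sample means are
  \<open>\<delta>\<close>-close to the true means (which forces the best arm, as \<open>2 \<delta> < \<Delta>\<^sub>2\<close>) except with probability at
  most \<open>2 N t\<^sup>-\<^sup>p\<close>, where \<open>p = a \<delta>\<^sup>2 w > 1\<close>. Summing over \<open>t\<close> gives \<open>2 N / (p - 1)\<close>, and time 1
  contributes the remaining constant.
\<close>

section \<open>Laws of sums of i.i.d. variables\<close>

text \<open>Each further summand convolves the law with \<open>D\<close>, so the law of the sum is a
  convolution power that depends only on the number of summands.\<close>

lemma (in prob_space) distr_sum_iid_cong:
  fixes X :: "'i \<Rightarrow> 'a \<Rightarrow> real"
  assumes indep: "indep_vars (\<lambda>_. borel) X I"
    and D: "\<And>i. i \<in> I \<Longrightarrow> distr M borel (X i) = D"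
    and S: "finite S" "S \<subseteq> I" and S': "finite S'" "S' \<subseteq> I" "card S = card S'"
  shows "distr M borel (\<lambda>\<omega>. \<Sum>i\<in>S. X i \<omega>) = distr M borel (\<lambda>\<omega>. \<Sum>i\<in>S'. X i \<omega>)"
proof -
  have meas: "random_variable borel (X i)" if "i \<in> I" for i
    using indep that by (auto simp: indep_vars_def2)
  have step: "distr M borel (\<lambda>\<omega>. \<Sum>i\<in>insert k F. X i \<omega>) =
      convolution D (distr M borel (\<lambda>\<omega>. \<Sum>i\<in>F. X i \<omega>))"
    if "finite F" "k \<notin> F" "insert k F \<subseteq> I" for k F
  proof -
    have "indep_var borel (X k) borel (\<lambda>\<omega>. \<Sum>i\<in>F. X i \<omega>)"
      using that indep_vars_subset[OF indep that(3)] by (intro indep_vars_sum) auto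
    moreover have "random_variable borel (\<lambda>\<omega>. \<Sum>i\<in>F. X i \<omega>)"
      using that meas by (intro borel_measurable_sum) auto
    ultimately have "distr M borel (\<lambda>\<omega>. X k \<omega> + (\<Sum>i\<in>F. X i \<omega>)) =
        convolution (distr M borel (X k)) (distr M borel (\<lambda>\<omega>. \<Sum>i\<in>F. X i \<omega>))"
      using that meas by (intro sum_indep_random_variable) auto
    then show ?thesis using that D[of k] by simp
  qed
  show ?thesis
    using S S'
  proof (induction S arbitrary: S' rule: finite_induct)
    case empty
    then show ?case by simp
  next
    case (insert k F)
    then obtain l G where G: "S' = insert l G" "l \<notin> G" "card G = card F" "finite G"
      by (metis card_Suc_eq card_insert_disjoint finite_insert)
    then show ?case
      using insert.IH[of G] insert.hyps insert.prems step[of F k] step[of G l] by auto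
  qed
qed

section \<open>Histories generated by a policy and their measurability\<close>

lemma policy_arm:
  assumes "is_policy N \<pi>" "1 \<le> t" "h \<in> space (history_space N (t - 1))"
  shows "\<pi> t u h \<in> {1..N}"
proof -
  have "(\<lambda>(u, h). \<pi> t u h) \<in> borel \<Otimes>\<^sub>M history_space N (t - 1) \<rightarrow>\<^sub>M count_space {1..N}"
    using assms by (auto simp: is_policy_def)
  from measurable_space[OF this, of "(u, h)"] show ?thesis
    using assms by (simp add: space_pair_measure)
qed

lemma run_in_history_space:
  assumes "is_policy N \<pi>"
  shows "run \<pi> u x t \<in> space (history_space N t)"
proof (induction t)
  case 0
  then show ?case by (simp add: history_space_def space_PiM)
next
  case (Suc t)
  then have "\<pi> (Suc t) u (run \<pi> u x t) \<in> {1..N}"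
    using policy_arm[OF assms, of "Suc t"] by simp
  then show ?case
    using Suc by (auto simp: history_space_def space_PiM space_pair_measure PiE_iff Let_def
        extensional_def)
qed

text \<open>A policy always picks an arm in \<open>{1..N}\<close>, so a run of length
  \<open>t\<close> reads only this part of the table. This allows the table to be replaced by a
  restriction of it.\<close>

lemma run_cong:
  assumes "is_policy N \<pi>" and "\<And>n s. n \<in> {1..N} \<Longrightarrow> s \<in> {1..t} \<Longrightarrow> x n s = y n s"
  shows "run \<pi> u x t = run \<pi> u y t"
  using assms(2)
proof (induction t)
  case (Suc t)
  have "run \<pi> u x t = run \<pi> u y t" using Suc by simp
  moreover have "\<pi> (Suc t) u (run \<pi> u y t) \<in> {1..N}"
    using policy_arm[OF assms(1), of "Suc t"] run_in_history_space[OF assms(1)] by simp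
  ultimately show ?case using Suc.prems by (simp add: Let_def)
qed simp

text \<open>Each step writes only at its own time; earlier entries are never overwritten.\<close>

lemma run_stable: "s \<le> t \<Longrightarrow> run \<pi> u x t s = run \<pi> u x s s"
  by (induction t) (auto simp: le_Suc_eq)

lemma run_nth:
  assumes "1 \<le> t"
  shows "run \<pi> u x t t = (let n = \<pi> t u (run \<pi> u x (t - 1)) in (n, x n t))"
  using assms by (cases t) auto

lemma measurable_run:
  assumes \<pi>: "is_policy N \<pi>"
    and u: "u \<in> borel_measurable K"
    and x: "\<And>n s. n \<in> {1..N} \<Longrightarrow> s \<in> {1..t} \<Longrightarrow> (\<lambda>z. x z n s) \<in> borel_measurable K"
  shows "(\<lambda>z. run \<pi> (u z) (x z) t) \<in> K \<rightarrow>\<^sub>M history_space N t"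
  using x
proof (induction t)
  case 0
  then show ?case by (simp add: history_space_def space_PiM measurable_const)
next
  case (Suc t)
  let ?n = "\<lambda>z. \<pi> (Suc t) (u z) (run \<pi> (u z) (x z) t)"
  have IH: "(\<lambda>z. run \<pi> (u z) (x z) t) \<in> K \<rightarrow>\<^sub>M history_space N t"
    using Suc by simp
  have "(\<lambda>(u, h). \<pi> (Suc t) u h) \<in> borel \<Otimes>\<^sub>M history_space N t \<rightarrow>\<^sub>M count_space {1..N}"
    using \<pi> by (auto simp: is_policy_def dest: spec[of _ "Suc t"])
  from measurable_compose[OF measurable_Pair[OF u IH] this]
  have n: "?n \<in> K \<rightarrow>\<^sub>M count_space {1..N}" by simp
  \<comment> \<open>The arm whose reward is read is itself random, but it has only finitely many
    values, so measurability for each fixed arm suffices.\<close>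
  have "(\<lambda>z. x z (?n z) (Suc t)) \<in> borel_measurable K"
    by (rule measurable_compose_countable'[OF _ n]) (use Suc.prems in auto)
  then show ?case
    using n IH unfolding history_space_def run.simps Let_def
    by (intro measurable_fun_upd[where J = "{1..t}"] measurable_Pair) auto
qed

section \<open>Exploration sequences and the round-robin order\<close>

text \<open>At an exploration time \<open>s\<close>, \<open>card (A s)\<close> is the rank of
  \<open>s\<close> among all exploration times. Sums over exploration times can thus be rewritten as
  sums over ranks.\<close>

lemma bij_betw_card_exploration:
  assumes A: "exploration_sequence A"
  shows "A t \<subseteq> {1..t} \<and> bij_betw (\<lambda>s. card (A s)) (A t) {1..card (A t)}"
proof (induction t)
  case 0
  then show ?case using A by (simp add: exploration_sequence_def bij_betw_def)
next
  case (Suc t)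
  then have fin: "finite (A t)" and "Suc t \<notin> A t" by (auto intro: finite_subset)
  have "A (Suc t) = A t \<or> A (Suc t) = A t \<union> {Suc t}"
    using A by (auto simp: exploration_sequence_def dest!: spec[of _ "Suc t"])
  then show ?case
  proof
    assume "A (Suc t) = A t"
    then show ?thesis using Suc by auto
  next
    assume *: "A (Suc t) = A t \<union> {Suc t}"
    then have "card (A (Suc t)) = Suc (card (A t))" using fin \<open>Suc t \<notin> A t\<close> by simp
    moreover have "{1..Suc (card (A t))} = {1..card (A t)} \<union> {Suc (card (A t))}" by auto
    ultimately show ?thesis
      using Suc * notIn_Un_bij_betw[of "Suc t" "A t" "\<lambda>s. card (A s)" "{1..card (A t)}"] \<open>Suc t \<notin> A t\<close>
      by auto
  qed
qed

lemma exploration_mono: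
  assumes "exploration_sequence A" "s \<le> t"
  shows "A s \<subseteq> A t"
  using assms(2)
proof (induction t)
  case (Suc t)
  have "A (Suc t) = A t \<or> A (Suc t) = A t \<union> {Suc t}"
    using assms(1) by (auto simp: exploration_sequence_def dest!: spec[of _ "Suc t"])
  then show ?case using Suc by (auto simp: le_Suc_eq)
qed simp

text \<open>A time can enter the sequence only at that very time.\<close>

lemma exploration_mem:
  assumes "exploration_sequence A" "s \<in> A t"
  shows "s \<in> A s"
  using assms(2)
proof (induction t)
  case 0
  then show ?case using assms(1) by (simp add: exploration_sequence_def)
next
  case (Suc t)
  have "A (Suc t) = A t \<or> A (Suc t) = A t \<union> {Suc t}"
    using assms(1) by (auto simp: exploration_sequence_def dest!: spec[of _ "Suc t"])
  then show ?case using Suc by auto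
qed

text \<open>Every block of \<open>N\<close> consecutive ranks visits each arm exactly once.\<close>

lemma sum_oslash:
  fixes g :: "nat \<Rightarrow> real"
  assumes "0 < N"
  shows "(\<Sum>k=1..N * L. g (k \<oslash> N)) = real L * (\<Sum>n=1..N. g n)"
proof (induction L)
  case (Suc L)
  have "(\<Sum>k=1..N * Suc L. g (k \<oslash> N)) = (\<Sum>k=1..N * L. g (k \<oslash> N)) + (\<Sum>k=1+N*L..N+N*L. g (k \<oslash> N))"
    using sum.ub_add_nat[of 1 "N * L" "\<lambda>k. g (k \<oslash> N)" N] by (simp add: add.commute)
  also have "(\<Sum>k=1+N*L..N+N*L. g (k \<oslash> N)) = (\<Sum>n=1..N. g ((n + N * L) \<oslash> N))"
    by (subst sum.shift_bounds_cl_nat_ivl) simp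
  also have "\<dots> = (\<Sum>n=1..N. g n)"
  proof (rule sum.cong)
    fix n assume "n \<in> {1..N}"
    then have "(n + N * L) - 1 = (n - 1) + N * L" "n - 1 < N" by auto
    then have "((n + N * L) - 1) mod N = n - 1" by (metis mod_mult_self2 mod_less)
    then show "g ((n + N * L) \<oslash> N) = g n"
      using \<open>n \<in> {1..N}\<close> by (simp add: oslash_def)
  qed simp
  finally show ?case using Suc by (simp add: algebra_simps)
qed simp

text \<open>A discrete form of the integral comparison: \<open>(p - 1) * t powr - p\<close> is at
  most a difference of consecutive values of \<open>t powr (1 - p)\<close>, and these differences
  telescope.\<close>

lemma sum_powr_le:
  fixes p :: real
  assumes p: "1 < p"
  shows "(\<Sum>t=2..T. real t powr - p) \<le> 1 / (p - 1)"
proof -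
  have step: "(p - 1) * real (Suc t) powr - p \<le> real t powr (1 - p) - real (Suc t) powr (1 - p)"
    if "1 \<le> t" for t
  proof -
    \<comment> \<open>After division by \<open>real (Suc t) powr (1 - p)\<close> the claim becomes
      the Bernoulli-type inequality \<open>1 + (p - 1) * y \<le> (1 - y) powr (1 - p)\<close>, which
      follows from \<open>1 + z \<le> exp z\<close> and \<open>ln (1 - y) \<le> - y\<close>.\<close>
    define y where "y = 1 / real (Suc t)"
    have y: "0 < y" "y < 1" using that by (auto simp: y_def)
    have t: "real t = real (Suc t) * (1 - y)"
      by (simp add: y_def field_simps)
    have "1 + (p - 1) * y \<le> exp ((p - 1) * y)"
      by (rule exp_ge_add_one_self)
    also have "\<dots> \<le> exp ((p - 1) * (- ln (1 - y)))"
      using ln_le_minus_one[of "1 - y"] y p by (simp only: exp_le_cancel_iff) (intro mult_left_mono, auto)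
    also have "\<dots> = (1 - y) powr (1 - p)"
      using y by (simp add: powr_def algebra_simps)
    finally have "real (Suc t) powr (1 - p) * (1 + (p - 1) * y)
        \<le> real (Suc t) powr (1 - p) * (1 - y) powr (1 - p)"
      by (intro mult_left_mono) auto
    moreover have "real (Suc t) powr (1 - p) * (1 - y) powr (1 - p) = real t powr (1 - p)"
      unfolding t using y by (subst powr_mult) auto
    moreover have "real (Suc t) powr (1 - p) * y = real (Suc t) powr - p"
      by (simp add: y_def powr_diff powr_minus field_simps)
    ultimately show ?thesis by (simp add: algebra_simps)
  qed
  \<comment> \<open>With upper limit \<open>Suc T\<close> the induction starts at an empty sum,
    where the right-hand side is \<open>1 - 1 = 0\<close>.\<close>
  have "(p - 1) * (\<Sum>t=2..Suc T. real t powr - p) \<le> 1 - real (Suc T) powr (1 - p)" for T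
  proof (induction T)
    case (Suc T)
    have "(\<Sum>t=2..Suc (Suc T). real t powr - p) = (\<Sum>t=2..Suc T. real t powr - p) + real (Suc (Suc T)) powr - p"
      by simp
    then show ?case using Suc step[of "Suc T"] by (simp only: distrib_left) simp
  qed simp
  note this[of T]
  moreover have "(\<Sum>t=2..T. real t powr - p) \<le> (\<Sum>t=2..Suc T. real t powr - p)"
    by (rule sum_mono2) auto
  ultimately have "(p - 1) * (\<Sum>t=2..T. real t powr - p) \<le> 1"
    using p by (smt (verit) mult_left_mono powr_ge_zero)
  then show ?thesis using p by (simp add: field_simps)
qed

section \<open>Moments, independence of the chosen arm, and the regret decomposition\<close>

context bandit
begin

lemma measurable_U: "random_variable borel U"
  using indep unfolding indep_vars_def2 by (auto dest: bspec[of _ _ None])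

lemma measurable_X: "n \<in> {1..N} \<Longrightarrow> 1 \<le> t \<Longrightarrow> random_variable borel (X n t)"
  using indep unfolding indep_vars_def2 by (auto dest: bspec[of _ _ "Some (n, t)"])

lemma integrable_X:
  assumes "n \<in> {1..N}" "1 \<le> t"
  shows "integrable M (X n t)"
  using finite_mean[OF assms(1)] measurable_X[OF assms]
  unfolding distr[OF assms, symmetric] by (simp add: integrable_distr_eq)

lemma expectation_X:
  assumes "n \<in> {1..N}" "1 \<le> t"
  shows "expectation (X n t) = mean f n"
  using measurable_X[OF assms]
  unfolding mean_def distr[OF assms, symmetric] by (simp add: integral_distr)

text \<open>
  Concentration is assumed for the samples at times \<open>1, \<dots>, s\<close>, whereas the policy averages over the
  exploration times of an arm.
\<close>

lemma prob_sample_mean_cong: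
  assumes n: "n \<in> {1..N}" and S: "finite S" "S \<subseteq> {1..}"
  shows "prob {\<omega> \<in> space M. d \<le> \<bar>(\<Sum>t\<in>S. X n t \<omega>) / real (card S) - \<mu>\<bar>} =
    prob {\<omega> \<in> space M. d \<le> \<bar>1 / real (card S) * (\<Sum>t=1..card S. X n t \<omega>) - \<mu>\<bar>}"
proof -
  let ?V = "\<lambda>i. case i of None \<Rightarrow> U | Some (n, t) \<Rightarrow> X n t"
  have "distr M borel (\<lambda>\<omega>. \<Sum>i\<in>(\<lambda>t. Some (n, t)) ` S. ?V i \<omega>) =
      distr M borel (\<lambda>\<omega>. \<Sum>i\<in>(\<lambda>t. Some (n, t)) ` {1..card S}. ?V i \<omega>)"
  proof (rule distr_sum_iid_cong)
    show "indep_vars (\<lambda>_. borel) ?V ((\<lambda>t. Some (n, t)) ` {1..})"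
      by (rule indep_vars_subset[OF indep]) (use n in auto)
    show "distr M borel (?V i) = f n" if "i \<in> (\<lambda>t. Some (n, t)) ` {1..}" for i
      using that n by (auto simp: distr)
    have inj: "inj_on (\<lambda>t. Some (n, t)) B" for B :: "nat set" by (auto intro: inj_onI)
    show "card ((\<lambda>t. Some (n, t)) ` S) = card ((\<lambda>t. Some (n, t)) ` {1..card S})"
      by (simp add: card_image[OF inj])
  qed (use S in auto)
  then have eq: "distr M borel (\<lambda>\<omega>. \<Sum>t\<in>S. X n t \<omega>) = distr M borel (\<lambda>\<omega>. \<Sum>t=1..card S. X n t \<omega>)"
    by (subst (asm) (1 2) sum.reindex) (auto intro: inj_onI simp: o_def)
  let ?B = "{y :: real. d \<le> \<bar>y / real (card S) - \<mu>\<bar>}"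
  have B: "?B \<in> sets borel" by measurable
  have *: "prob {\<omega> \<in> space M. d \<le> \<bar>(\<Sum>t\<in>S'. X n t \<omega>) / real (card S) - \<mu>\<bar>} =
      measure (distr M borel (\<lambda>\<omega>. \<Sum>t\<in>S'. X n t \<omega>)) ?B" if "S' \<subseteq> {1..}" for S'
    using that n B by (subst measure_distr) 
      (auto intro!: borel_measurable_sum measurable_X arg_cong[where f = prob])
  show ?thesis
    using *[of S] *[of "{1..card S}"] S eq by auto
qed

definition played :: "policy \<Rightarrow> nat \<Rightarrow> 'a \<Rightarrow> nat" where
  "played \<pi> t \<omega> = fst (run \<pi> (U \<omega>) (\<lambda>n s. X n s \<omega>) t t)"

lemma played_eq:
  "1 \<le> t \<Longrightarrow> played \<pi> t \<omega> = \<pi> t (U \<omega>) (run \<pi> (U \<omega>) (\<lambda>n s. X n s \<omega>) (t - 1))"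
  by (simp add: played_def run_nth Let_def)

lemma obtained_reward_eq:
  "1 \<le> t \<Longrightarrow> obtained_reward X U \<pi> t \<omega> = X (played \<pi> t \<omega>) t \<omega>"
  by (simp add: played_def obtained_reward_def run_nth Let_def)

lemma played_in_arms:
  "is_policy N \<pi> \<Longrightarrow> 1 \<le> t \<Longrightarrow> played \<pi> t \<omega> \<in> {1..N}"
  by (simp only: played_eq policy_arm run_in_history_space)

text \<open>The space \<open>K\<close> is left general for two uses: on \<open>M\<close> itself, and
  on the product of the earlier coordinates, where the arm appears as a function of these
  coordinates alone.\<close>

lemma measurable_next_arm:
  assumes \<pi>: "is_policy N \<pi>" and t: "1 \<le> t"
    and u: "u \<in> borel_measurable K"
    and x: "\<And>n s. n \<in> {1..N} \<Longrightarrow> s \<in> {1..t - 1} \<Longrightarrow> (\<lambda>z. x z n s) \<in> borel_measurable K"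
  shows "(\<lambda>z. \<pi> t (u z) (run \<pi> (u z) (x z) (t - 1))) \<in> K \<rightarrow>\<^sub>M count_space {1..N}"
proof -
  have "(\<lambda>(u, h). \<pi> t u h) \<in> borel \<Otimes>\<^sub>M history_space N (t - 1) \<rightarrow>\<^sub>M count_space {1..N}"
    using \<pi> t by (auto simp: is_policy_def)
  from measurable_compose[OF measurable_Pair[OF u measurable_run[OF \<pi> u x]] this]
  show ?thesis by simp
qed

lemma measurable_played:
  assumes "is_policy N \<pi>" "1 \<le> t"
  shows "played \<pi> t \<in> M \<rightarrow>\<^sub>M count_space {1..N}"
  unfolding played_eq[OF assms(2), abs_def]
  by (rule measurable_next_arm[OF assms measurable_U]) (auto intro: measurable_X)

text \<open>The arm at time \<open>t\<close> is a measurable function of \<open>U\<close> and the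
  rewards before \<open>t\<close>, an index set disjoint from \<open>{Some (n, t)}\<close>.\<close>

lemma indep_var_played:
  assumes \<pi>: "is_policy N \<pi>" and t: "1 \<le> t" and n: "n \<in> {1..N}"
  shows "indep_var borel (\<lambda>\<omega>. indicator {n} (played \<pi> t \<omega>) :: real) borel (X n t)"
proof -
  let ?V = "\<lambda>i. case i of None \<Rightarrow> U | Some (n, t) \<Rightarrow> X n t"
  let ?J = "insert None (Some ` ({1..N} \<times> {1..t - 1}))"
  let ?g = "\<lambda>z. indicator {n} (\<pi> t (z None) (run \<pi> (z None) (\<lambda>n s. z (Some (n, s))) (t - 1))) :: real"
  have "(\<lambda>z. \<pi> t (z None) (run \<pi> (z None) (\<lambda>n s. z (Some (n, s))) (t - 1)))
      \<in> (\<Pi>\<^sub>M i\<in>?J. borel) \<rightarrow>\<^sub>M count_space {1..N}"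
    by (rule measurable_next_arm[OF \<pi> t]) (auto intro!: measurable_component_singleton)
  then have g: "?g \<in> borel_measurable (\<Pi>\<^sub>M i\<in>?J. borel)"
    by (rule measurable_compose) simp
  have "indep_var borel (?g \<circ> (\<lambda>\<omega>. restrict (\<lambda>i. ?V i \<omega>) ?J))
      borel ((\<lambda>z. z (Some (n, t))) \<circ> (\<lambda>\<omega>. restrict (\<lambda>i. ?V i \<omega>) {Some (n, t)}))"
    using t n by (intro indep_var_compose[OF indep_var_restrict[OF indep]] g) auto
  moreover have "?g \<circ> (\<lambda>\<omega>. restrict (\<lambda>i. ?V i \<omega>) ?J) = (\<lambda>\<omega>. indicator {n} (played \<pi> t \<omega>))"
  proof
    fix \<omega>
    \<comment> \<open>Restriction to \<open>?J\<close> keeps \<open>U\<close> and the rewards of all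
      arms up to time \<open>t - 1\<close>, which is all that a run of this length reads.\<close>
    have "run \<pi> (U \<omega>) (\<lambda>n s. restrict (\<lambda>i. ?V i \<omega>) ?J (Some (n, s))) (t - 1) =
        run \<pi> (U \<omega>) (\<lambda>n s. X n s \<omega>) (t - 1)"
      by (rule run_cong[OF \<pi>]) auto
    then show "(?g \<circ> (\<lambda>\<omega>. restrict (\<lambda>i. ?V i \<omega>) ?J)) \<omega> = indicator {n} (played \<pi> t \<omega>)"
      by (simp add: played_eq[OF t])
  qed
  moreover have "(\<lambda>z. z (Some (n, t))) \<circ> (\<lambda>\<omega>. restrict (\<lambda>i. ?V i \<omega>) {Some (n, t)}) = X n t"
    by auto
  ultimately show ?thesis by simp
qed

text \<open>Conditioning on the arm without conditional expectations: the reward is split by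
  indicators of the chosen arm, and independence factors each product.\<close>

lemma
  assumes \<pi>: "is_policy N \<pi>" and t: "1 \<le> t"
  shows integrable_obtained_reward: "integrable M (obtained_reward X U \<pi> t)"
    and expectation_obtained_reward:
      "expectation (obtained_reward X U \<pi> t) = expectation (\<lambda>\<omega>. mean f (played \<pi> t \<omega>))"
    and integrable_mean_played: "integrable M (\<lambda>\<omega>. mean f (played \<pi> t \<omega>))"
proof -
  let ?I = "\<lambda>n \<omega>. indicator {n} (played \<pi> t \<omega>) :: real"
  \<comment> \<open>Exactly one indicator is nonzero, which turns a random index into a finite sum
    over fixed arms.\<close>
  have split: "(\<lambda>\<omega>. g (played \<pi> t \<omega>) \<omega>) = (\<lambda>\<omega>. \<Sum>n=1..N. ?I n \<omega> * g n \<omega>)" for g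
  proof
    fix \<omega>
    have "(\<Sum>n=1..N. ?I n \<omega> * g n \<omega>) = (\<Sum>n\<in>{1..N}. if n = played \<pi> t \<omega> then g n \<omega> else 0)"
      by (rule sum.cong) (auto simp: indicator_def)
    then show "g (played \<pi> t \<omega>) \<omega> = (\<Sum>n=1..N. ?I n \<omega> * g n \<omega>)"
      using played_in_arms[OF \<pi> t, of \<omega>] by simp
  qed
  have "?I n \<in> borel_measurable M" for n
    by (rule measurable_compose[OF measurable_played[OF \<pi> t]]) simp
  then have I: "integrable M (?I n)" for n
    by (rule integrable_const_bound[where B = 1, rotated]) auto
  have rew: "obtained_reward X U \<pi> t = (\<lambda>\<omega>. \<Sum>n=1..N. ?I n \<omega> * X n t \<omega>)"
    unfolding obtained_reward_eq[OF t, abs_def] by (rule split)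
  have mean: "(\<lambda>\<omega>. mean f (played \<pi> t \<omega>)) = (\<lambda>\<omega>. \<Sum>n=1..N. ?I n \<omega> * mean f n)"
    using split[of "\<lambda>n _. mean f n"] .
  have int: "integrable M (\<lambda>\<omega>. ?I n \<omega> * X n t \<omega>)"
    and ex: "expectation (\<lambda>\<omega>. ?I n \<omega> * X n t \<omega>) = expectation (?I n) * mean f n" if "n \<in> {1..N}" for n
    using indep_var_integrable[OF indep_var_played[OF \<pi> t that] I integrable_X[OF that t]]
      indep_var_lebesgue_integral[OF indep_var_played[OF \<pi> t that] I integrable_X[OF that t]]
      expectation_X[OF that t] by simp_all
  show "integrable M (obtained_reward X U \<pi> t)"
    unfolding rew using int by (intro Bochner_Integration.integrable_sum) auto
  show "integrable M (\<lambda>\<omega>. mean f (played \<pi> t \<omega>))"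
    unfolding mean using I by (intro Bochner_Integration.integrable_sum integrable_mult_left)
  show "expectation (obtained_reward X U \<pi> t) = expectation (\<lambda>\<omega>. mean f (played \<pi> t \<omega>))"
  proof -
    have "expectation (\<lambda>\<omega>. \<Sum>n=1..N. ?I n \<omega> * X n t \<omega>) = (\<Sum>n=1..N. expectation (?I n) * mean f n)"
      by (subst Bochner_Integration.integral_sum[OF int]) (simp_all only: ex cong: sum.cong)
    also have "\<dots> = expectation (\<lambda>\<omega>. \<Sum>n=1..N. ?I n \<omega> * mean f n)"
      by (subst Bochner_Integration.integral_sum[OF integrable_mult_left[OF I]]) simp
    finally show ?thesis unfolding rew mean .
  qed
qed

lemma regret_eq:
  assumes "is_policy N \<pi>"
  shows "regret M f X U \<sigma> \<pi> T = (\<Sum>t=1..T. expectation (\<lambda>\<omega>. mean f (\<sigma> 1) - mean f (played \<pi> t \<omega>)))"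
proof -
  have "expectation (\<lambda>\<omega>. mean f (\<sigma> 1) - mean f (played \<pi> t \<omega>)) =
      mean f (\<sigma> 1) - expectation (obtained_reward X U \<pi> t)" if "1 \<le> t" for t
    using integrable_mean_played[OF assms that] expectation_obtained_reward[OF assms that]
    by (simp add: prob_space)
  then show ?thesis
    using integrable_obtained_reward[OF assms]
    by (simp add: regret_def Bochner_Integration.integral_sum sum_subtractf)
qed

end

section \<open>Counting explorations and ordering the means\<close>

text \<open>The deterministic counterpart of \<open>sample_times\<close>: it is read off the
  schedule rather than from an observed history.\<close>

definition sampled :: "nat \<Rightarrow> (nat \<Rightarrow> nat set) \<Rightarrow> nat \<Rightarrow> nat \<Rightarrow> nat set" where
  "sampled N A t n = {s \<in> A t. card (A s) \<oslash> N = n}"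

text \<open>The ranks \<open>n\<close>, \<open>N + n\<close>, ..., \<open>(L - 1) * N + n\<close>
  all belong to arm \<open>n\<close>, and they are at most \<open>N * L\<close> since
  \<open>n \<le> N\<close>.\<close>

lemma card_sampled_ge:
  assumes A: "exploration_sequence A" and n: "n \<in> {1..N}" and L: "N * L \<le> card (A t)"
  shows "L \<le> card (sampled N A t n)"
proof -
  have bij: "bij_betw (\<lambda>s. card (A s)) (A t) {1..card (A t)}"
    using bij_betw_card_exploration[OF A] by simp
  have sub: "(\<lambda>j. j * N + n) ` {..<L} \<subseteq> (\<lambda>s. card (A s)) ` sampled N A t n"
  proof (rule image_subsetI)
    fix j assume "j \<in> {..<L}"
    then have "(j + 1) * N \<le> L * N" by (intro mult_right_mono) auto
    then have "j * N + n \<in> {1..card (A t)}" using n L by (simp add: mult.commute)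
    then obtain s where s: "s \<in> A t" "card (A s) = j * N + n"
      using bij by (metis bij_betw_imp_surj_on imageE)
    have "(j * N + n - 1) mod N = n - 1"
    proof -
      have "j * N + n - 1 = (n - 1) + j * N" "n - 1 < N" using n by auto
      then show ?thesis by (metis mod_mult_self1 mod_less)
    qed
    then have "s \<in> sampled N A t n" using s n by (simp add: sampled_def oslash_def)
    then show "j * N + n \<in> (\<lambda>s. card (A s)) ` sampled N A t n" using s(2) by (metis imageI)
  qed
  have fin: "finite (sampled N A t n)"
    using bij_betw_card_exploration[OF A, of t] by (auto simp: sampled_def intro: finite_subset)
  have "inj_on (\<lambda>j. j * N + n) {..<L}" using n by (auto intro: inj_onI)
  then have "L = card ((\<lambda>j. j * N + n) ` {..<L})" by (simp add: card_image)
  also have "\<dots> \<le> card ((\<lambda>s. card (A s)) ` sampled N A t n)"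
    using sub fin by (intro card_mono) auto
  also have "\<dots> \<le> card (sampled N A t n)" using fin by (rule card_image_le)
  finally show ?thesis .
qed

text \<open>A time is added only while the count is strictly below the integer threshold, so adding
  one cannot overshoot; otherwise the count stays and the threshold does not decrease.\<close>

lemma card_exploration_le:
  assumes A: "exploration_sequence A" and w: "0 \<le> w"
    and mem: "\<And>t. t > 1 \<Longrightarrow> t \<in> A t \<longleftrightarrow> int (card (A (t - 1))) < int N * \<lceil>w * ln (real t)\<rceil>"
    and t: "1 \<le> t"
  shows "int (card (A t)) \<le> int N * \<lceil>w * ln (real t)\<rceil>"
  using t
proof (induction t rule: dec_induct)
  case base
  then show ?case using A by (simp add: exploration_sequence_def)
next
  case (step t)
  have fin: "finite (A t)" using bij_betw_card_exploration[OF A, of t] by (auto intro: finite_subset)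
  have st: "A (Suc t) = A t \<or> A (Suc t) = A t \<union> {Suc t}"
    using A by (auto simp: exploration_sequence_def dest!: spec[of _ "Suc t"])
  show ?case
  proof (cases "Suc t \<in> A (Suc t)")
    case True
    then have "int (card (A t)) < int N * \<lceil>w * ln (real (Suc t))\<rceil>"
      using mem[of "Suc t"] step by simp
    moreover have "card (A (Suc t)) \<le> Suc (card (A t))"
      using st fin by (auto simp: card_insert_if)
    ultimately show ?thesis by linarith
  next
    case False
    then have "A (Suc t) = A t" using st by auto
    moreover have "\<lceil>w * ln (real t)\<rceil> \<le> \<lceil>w * ln (real (Suc t))\<rceil>"
      using step w by (intro ceiling_mono mult_left_mono) auto
    then have "int N * \<lceil>w * ln (real t)\<rceil> \<le> int N * \<lceil>w * ln (real (Suc t))\<rceil>"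
      by (intro mult_left_mono) auto
    ultimately show ?thesis using step.IH by (metis order_trans)
  qed
qed

text \<open>An incomplete last round is filled up to \<open>L\<close> full rounds, which only adds
  nonnegative terms.\<close>

lemma sum_exploration_le:
  fixes g :: "nat \<Rightarrow> real"
  assumes A: "exploration_sequence A" and N: "0 < N" and g: "\<And>n. n \<in> {1..N} \<Longrightarrow> 0 \<le> g n"
    and L: "card (A T) \<le> N * L"
  shows "(\<Sum>t\<in>A T. g (card (A t) \<oslash> N)) \<le> real L * (\<Sum>n=1..N. g n)"
proof -
  have "(\<Sum>t\<in>A T. g (card (A t) \<oslash> N)) = (\<Sum>k=1..card (A T). g (k \<oslash> N))"
    using bij_betw_card_exploration[OF A, of T] by (intro sum.reindex_bij_betw) auto
  also have "\<dots> \<le> (\<Sum>k=1..N * L. g (k \<oslash> N))"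
    using L N by (intro sum_mono2 g) (auto simp: oslash_def Suc_le_eq)
  finally show ?thesis using sum_oslash[OF N] by simp
qed

text \<open>Every arm is \<open>\<sigma> i\<close> for some rank \<open>i\<close>, and the gap grows
  with the rank: it is largest at rank \<open>N\<close>, and among the arms other than
  \<open>\<sigma> 1\<close> it is smallest at rank 2.\<close>

lemma
  assumes \<sigma>: "sorts_means N f \<sigma>" and N: "1 \<le> N" and n: "n \<in> {1..N}"
  shows mean_le_best: "mean f n \<le> mean f (\<sigma> 1)"
    and best_minus_mean_le_gap: "mean f (\<sigma> 1) - mean f n \<le> gap f \<sigma> N"
    and gap_2_le: "n \<noteq> \<sigma> 1 \<Longrightarrow> gap f \<sigma> 2 \<le> mean f (\<sigma> 1) - mean f n"
proof -
  obtain i where i: "i \<in> {1..N}" "n = \<sigma> i"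
    using \<sigma> n unfolding sorts_means_def by (metis permutes_image imageE)
  have mono: "mean f (\<sigma> j) \<le> mean f (\<sigma> i)" if "i \<in> {1..N}" "j \<in> {1..N}" "i \<le> j" for i j
    using \<sigma> that unfolding sorts_means_def by blast
  show "mean f n \<le> mean f (\<sigma> 1)" "mean f (\<sigma> 1) - mean f n \<le> gap f \<sigma> N"
    using mono[of 1 i] mono[of i N] i N by (auto simp: gap_def)
  show "gap f \<sigma> 2 \<le> mean f (\<sigma> 1) - mean f n" if "n \<noteq> \<sigma> 1"
  proof -
    have "i \<noteq> 1" using i that by auto
    then show ?thesis using mono[of 2 i] i by (auto simp: gap_def)
  qed
qed

text \<open>Reindexing by \<open>\<sigma>\<close> turns losses into gaps, and the gap at rank 1
  vanishes.\<close>

lemma sum_gap: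
  assumes \<sigma>: "sorts_means N f \<sigma>" and N: "1 \<le> N"
  shows "(\<Sum>n=1..N. mean f (\<sigma> 1) - mean f n) = (\<Sum>n=2..N. gap f \<sigma> n)"
proof -
  have "(\<Sum>n=1..N. mean f (\<sigma> 1) - mean f n) = (\<Sum>n=1..N. gap f \<sigma> n)"
    using \<sigma> sum.permute[of \<sigma> "{1..N}" "\<lambda>n. mean f (\<sigma> 1) - mean f n"]
    by (simp add: sorts_means_def gap_def o_def)
  then show ?thesis
    using N by (simp add: sum.atLeast_Suc_atMost gap_def numeral_2_eq_2)
qed

section \<open>Error probability at exploitation times\<close>

context bandit
begin

lemma played_exploration:
  assumes \<pi>: "dsee_policy N A \<pi>" and t: "1 \<le> t" "t \<in> A t"
  shows "played \<pi> t \<omega> = card (A t) \<oslash> N"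
  using \<pi> t run_in_history_space[of N \<pi> "U \<omega>" "\<lambda>n s. X n s \<omega>" "t - 1"]
  by (auto simp: dsee_policy_def played_eq)

text \<open>Exploration does not look at the observations, so the times at which an arm is sampled
  are the same for every outcome. The sample mean is therefore an average over a fixed set, to which
  the concentration bound applies.\<close>

lemma
  assumes \<pi>: "dsee_policy N A \<pi>" and A: "exploration_sequence A"
  defines "h \<equiv> \<lambda>\<omega> t. run \<pi> (U \<omega>) (\<lambda>n s. X n s \<omega>) (t - 1)"
  shows sample_times_run: "sample_times A (h \<omega> t) t n = sampled N A (t - 1) n"
    and sample_mean_run: "sample_mean A (h \<omega> t) t n =
      (\<Sum>s\<in>sampled N A (t - 1) n. X n s \<omega>) / real (card (sampled N A (t - 1) n))"
proof -
  have h: "fst (h \<omega> t s) = card (A s) \<oslash> N" "snd (h \<omega> t s) = X (card (A s) \<oslash> N) s \<omega>"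
    if "s \<in> A (t - 1)" for s
  proof -
    have s: "1 \<le> s" "s \<le> t - 1" "s \<in> A s"
      using that bij_betw_card_exploration[OF A, of "t - 1"] exploration_mem[OF A that] by auto
    then have "h \<omega> t s = run \<pi> (U \<omega>) (\<lambda>n s. X n s \<omega>) s s"
      unfolding h_def by (intro run_stable)
    then show "fst (h \<omega> t s) = card (A s) \<oslash> N" "snd (h \<omega> t s) = X (card (A s) \<oslash> N) s \<omega>"
      using played_exploration[OF \<pi> s(1,3), of \<omega>] played_eq[OF s(1), of \<pi> \<omega>]
      by (simp_all add: run_nth[OF s(1)] Let_def)
  qed
  show eq: "sample_times A (h \<omega> t) t n = sampled N A (t - 1) n"
    by (auto simp: sample_times_def sampled_def h)
  have "(\<Sum>s\<in>sampled N A (t - 1) n. snd (h \<omega> t s)) = (\<Sum>s\<in>sampled N A (t - 1) n. X n s \<omega>)"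
    by (rule sum.cong) (auto simp: sampled_def h)
  then show "sample_mean A (h \<omega> t) t n =
      (\<Sum>s\<in>sampled N A (t - 1) n. X n s \<omega>) / real (card (sampled N A (t - 1) n))"
    by (simp only: sample_mean_def eq)
qed

text \<open>With all estimates off by less than \<open>\<delta>\<close>, an arm that maximizes them
  has a mean less than \<open>2 * \<delta>\<close> below the best, whereas every arm other than
  \<open>\<sigma> 1\<close> is at least \<open>gap f \<sigma> 2\<close> below.\<close>

lemma played_exploitation:
  assumes \<pi>: "dsee_policy N A \<pi>" and A: "exploration_sequence A" and \<sigma>: "sorts_means N f \<sigma>"
    and t: "1 \<le> t" "t \<notin> A t"
    and ne: "\<And>n. n \<in> {1..N} \<Longrightarrow> sampled N A (t - 1) n \<noteq> {}"
    and close: "\<And>n. n \<in> {1..N} \<Longrightarrow>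
      \<bar>(\<Sum>s\<in>sampled N A (t - 1) n. X n s \<omega>) / real (card (sampled N A (t - 1) n)) - mean f n\<bar> < \<delta>"
    and \<delta>: "2 * \<delta> \<le> gap f \<sigma> 2"
  shows "played \<pi> t \<omega> = \<sigma> 1"
proof -
  have pol: "is_policy N \<pi>" using \<pi> by (simp add: dsee_policy_def)
  define h where "h = run \<pi> (U \<omega>) (\<lambda>n s. X n s \<omega>) (t - 1)"
  have h: "h \<in> space (history_space N (t - 1))"
    unfolding h_def by (rule run_in_history_space[OF pol])
  have "\<exists>m. (\<forall>n\<in>{1..N}. sample_times A h t n \<noteq> {} \<longrightarrow> m n = sample_mean A h t n) \<and>
      (\<forall>n\<in>{1..N}. m n \<le> m (\<pi> t (U \<omega>) h))"
    using \<pi>[unfolded dsee_policy_def, THEN conjunct2, rule_format, OF t(1) h, of "U \<omega>"]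
    by (simp only: t(2) if_False)
  then obtain m where m: "\<And>n. n \<in> {1..N} \<Longrightarrow> sample_times A h t n \<noteq> {} \<Longrightarrow> m n = sample_mean A h t n"
      "\<And>n. n \<in> {1..N} \<Longrightarrow> m n \<le> m (\<pi> t (U \<omega>) h)"
    by blast
  \<comment> \<open>Every arm has been sampled, so \<open>m\<close> is the sample mean throughout
    and none of its values is arbitrary.\<close>
  have close': "\<bar>m n - mean f n\<bar> < \<delta>" if "n \<in> {1..N}" for n
    using m(1)[OF that] ne[OF that] close[OF that]
    unfolding h_def sample_times_run[OF \<pi> A] sample_mean_run[OF \<pi> A] by simp
  have \<sigma>1: "\<sigma> 1 \<in> {1..N}"
    using \<sigma> two_arms permutes_in_image[of \<sigma> "{1..N}" 1] by (simp add: sorts_means_def)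
  have arm: "played \<pi> t \<omega> \<in> {1..N}" by (rule played_in_arms[OF pol t(1)])
  have "m (\<sigma> 1) \<le> m (played \<pi> t \<omega>)"
    using m(2)[OF \<sigma>1] by (simp add: played_eq[OF t(1)] h_def)
  then have "mean f (\<sigma> 1) - mean f (played \<pi> t \<omega>) < gap f \<sigma> 2"
    using close'[OF \<sigma>1] close'[OF arm] \<delta> by linarith
  then show ?thesis
    using gap_2_le[OF \<sigma> _ arm] two_arms by force
qed

text \<open>A wrong choice forces one of the \<open>N\<close> sample means to deviate by at least
  \<open>\<delta>\<close>; each rests on at least \<open>L\<close> samples, and more samples only
  lower the exponential bound.\<close>

lemma prob_suboptimal_le:
  assumes \<pi>: "dsee_policy N A \<pi>" and A: "exploration_sequence A" and \<sigma>: "sorts_means N f \<sigma>"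
    and t: "1 \<le> t" "t \<notin> A t"
    and L: "1 \<le> L" "N * L \<le> card (A (t - 1))"
    and a: "0 \<le> a"
    and conc: "\<And>n s. n \<in> {1..N} \<Longrightarrow> s \<ge> 1 \<Longrightarrow>
           prob {\<omega> \<in> space M. \<bar>1 / real s * (\<Sum>t=1..s. X n t \<omega>) - mean f n\<bar> \<ge> \<delta>}
             \<le> 2 * exp (- a * \<delta>\<^sup>2 * real s)"
    and \<delta>: "2 * \<delta> \<le> gap f \<sigma> 2"
  shows "prob {\<omega> \<in> space M. played \<pi> t \<omega> \<noteq> \<sigma> 1} \<le> 2 * real N * exp (- a * \<delta>\<^sup>2 * real L)"
proof -
  let ?S = "sampled N A (t - 1)"
  define B where "B n = {\<omega> \<in> space M. \<delta> \<le> \<bar>(\<Sum>s\<in>?S n. X n s \<omega>) / real (card (?S n)) - mean f n\<bar>}" for n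
  have S: "?S n \<subseteq> {1..}" "finite (?S n)" for n
    using bij_betw_card_exploration[OF A, of "t - 1"] by (auto simp: sampled_def intro: finite_subset)
  have cardS: "L \<le> card (?S n)" if "n \<in> {1..N}" for n
    by (rule card_sampled_ge[OF A that L(2)])
  have B: "B n \<in> events" if "n \<in> {1..N}" for n
  proof -
    have "(\<lambda>\<omega>. \<Sum>s\<in>?S n. X n s \<omega>) \<in> borel_measurable M"
      using S that by (intro borel_measurable_sum measurable_X) auto
    then show ?thesis unfolding B_def by measurable
  qed
  have "{\<omega> \<in> space M. played \<pi> t \<omega> \<noteq> \<sigma> 1} \<subseteq> (\<Union>n\<in>{1..N}. B n)"
  proof (rule subsetI, rule ccontr)
    fix \<omega> assume \<omega>: "\<omega> \<in> {\<omega> \<in> space M. played \<pi> t \<omega> \<noteq> \<sigma> 1}" "\<omega> \<notin> (\<Union>n\<in>{1..N}. B n)"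
    have "?S n \<noteq> {}" if "n \<in> {1..N}" for n using cardS[OF that] L(1) by force
    moreover have "\<bar>(\<Sum>s\<in>?S n. X n s \<omega>) / real (card (?S n)) - mean f n\<bar> < \<delta>" if "n \<in> {1..N}" for n
      using \<omega> that by (auto simp: B_def not_le)
    ultimately have "played \<pi> t \<omega> = \<sigma> 1"
      by (rule played_exploitation[OF \<pi> A \<sigma> t _ _ \<delta>])
    then show False using \<omega> by simp
  qed
  then have "prob {\<omega> \<in> space M. played \<pi> t \<omega> \<noteq> \<sigma> 1} \<le> prob (\<Union>n\<in>{1..N}. B n)"
    using B by (intro finite_measure_mono) auto
  also have "\<dots> \<le> (\<Sum>n=1..N. prob (B n))"
    using B by (intro finite_measure_subadditive_finite) auto
  also have "\<dots> \<le> (\<Sum>n=1..N. 2 * exp (- a * \<delta>\<^sup>2 * real L))"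
  proof (rule sum_mono)
    fix n assume n: "n \<in> {1..N}"
    have "prob (B n) \<le> 2 * exp (- a * \<delta>\<^sup>2 * real (card (?S n)))"
      unfolding B_def prob_sample_mean_cong[OF n S(2) S(1)]
      using conc[OF n] cardS[OF n] L(1) by simp
    also have "\<dots> \<le> 2 * exp (- a * \<delta>\<^sup>2 * real L)"
      using cardS[OF n] a by (simp add: mult_left_mono)
    finally show "prob (B n) \<le> 2 * exp (- a * \<delta>\<^sup>2 * real L)" .
  qed
  finally show ?thesis by simp
qed

text \<open>The loss is zero when \<open>\<sigma> 1\<close> is played and never exceeds the largest
  gap.\<close>

lemma expected_loss_le:
  assumes pol: "is_policy N \<pi>" and t: "1 \<le> t" and \<sigma>: "sorts_means N f \<sigma>"
  shows "expectation (\<lambda>\<omega>. mean f (\<sigma> 1) - mean f (played \<pi> t \<omega>))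
    \<le> gap f \<sigma> N * prob {\<omega> \<in> space M. played \<pi> t \<omega> \<noteq> \<sigma> 1}"
proof -
  let ?B = "{\<omega> \<in> space M. played \<pi> t \<omega> \<noteq> \<sigma> 1}"
  have "?B = played \<pi> t -` ({1..N} - {\<sigma> 1}) \<inter> space M"
    using played_in_arms[OF pol t] by auto
  then have B: "?B \<in> events"
    using measurable_sets[OF measurable_played[OF pol t], of "{1..N} - {\<sigma> 1}"] by simp
  have "expectation (\<lambda>\<omega>. mean f (\<sigma> 1) - mean f (played \<pi> t \<omega>))
      \<le> expectation (\<lambda>\<omega>. gap f \<sigma> N * indicator ?B \<omega>)"
  proof (rule integral_mono)
    show "integrable M (\<lambda>\<omega>. mean f (\<sigma> 1) - mean f (played \<pi> t \<omega>))"
      using integrable_mean_played[OF pol t] by simp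
    show "integrable M (\<lambda>\<omega>. gap f \<sigma> N * indicator ?B \<omega>)"
      using B by (intro integrable_mult_right integrable_real_indicator) (simp_all add: less_top[symmetric])
    show "mean f (\<sigma> 1) - mean f (played \<pi> t \<omega>) \<le> gap f \<sigma> N * indicator ?B \<omega>" if "\<omega> \<in> space M" for \<omega>
      using best_minus_mean_le_gap[OF \<sigma> _ played_in_arms[OF pol t]] two_arms that
      by (cases "played \<pi> t \<omega> = \<sigma> 1") auto
  qed
  then show ?thesis using B by simp
qed

end

section \<open>Assembly of the regret bound\<close>

theorem theorem1:
  fixes M :: "'a measure" and N :: nat and f :: "nat \<Rightarrow> real measure"
    and X :: "nat \<Rightarrow> nat \<Rightarrow> 'a \<Rightarrow> real" and U :: "'a \<Rightarrow> real"
    and \<sigma> :: "nat \<Rightarrow> nat" and A :: "nat \<Rightarrow> nat set" and \<pi> :: policy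
    and \<zeta> u0 a c \<delta> w :: real and T :: nat
  assumes "bandit M N f X U"
    and "sorts_means N f \<sigma>"
    and "\<And>n. n \<in> {1..N} \<Longrightarrow> light_tailed (f n) (\<lambda>x. x)"
    and "\<zeta> > 0" and "u0 > 0" and "a \<in> {0<..1 / (2 * \<zeta>)}"
    and "\<And>n s \<delta>'. n \<in> {1..N} \<Longrightarrow> s \<ge> 1 \<Longrightarrow> \<delta>' \<in> {0..\<zeta> * u0} \<Longrightarrow>
           measure M {\<omega> \<in> space M. \<bar>1 / real s * (\<Sum>t=1..s. X n t \<omega>) - mean f n\<bar> \<ge> \<delta>'}
             \<le> 2 * exp (- a * \<delta>'\<^sup>2 * real s)"
    and "c \<in> {0<..<gap f \<sigma> 2}"
    and "\<delta> = min (c / 2) (\<zeta> * u0)"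
    and "w > 1 / (a * \<delta>\<^sup>2)"
    and "exploration_sequence A"
    and "\<And>t. t > 1 \<Longrightarrow> t \<in> A t \<longleftrightarrow> int (card (A (t - 1))) < int N * \<lceil>w * ln (real t)\<rceil>"
    and "dsee_policy N A \<pi>"
    and "T \<ge> 1"
  shows "regret M f X U \<sigma> \<pi> T \<le>
           (\<Sum>n=2..N. of_int \<lceil>w * ln (real T)\<rceil> * gap f \<sigma> n)
           + 2 * real N * gap f \<sigma> N * (1 + 1 / (a * \<delta>\<^sup>2 * w - 1))"
proof -
  interpret bandit M N f X U by fact
  note \<sigma> = assms(2) and A = assms(11) and mem = assms(12) and \<pi> = assms(13)
  have pol: "is_policy N \<pi>" using \<pi> by (simp add: dsee_policy_def)
  have N: "1 \<le> N" using two_arms by simp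
  have a: "0 < a" and \<delta>: "0 < \<delta>" "\<delta> \<le> \<zeta> * u0" "2 * \<delta> \<le> gap f \<sigma> 2"
    using assms(4-6,8,9) by (auto simp: min_def)
  \<comment> \<open>The decay exponent of the error probability; the choice of \<open>w\<close> says
    exactly that \<open>p > 1\<close>, so that its powers are summable.\<close>
  define p where "p = a * \<delta>\<^sup>2 * w"
  have "0 < a * \<delta>\<^sup>2" using a \<delta> by simp
  then have p: "1 < p" and w: "0 < w"
    using assms(10) less_trans[OF _ assms(10), of 0]
    by (simp_all add: p_def pos_divide_less_eq mult.commute)
  have gap_N: "0 \<le> gap f \<sigma> N"
    using best_minus_mean_le_gap[OF \<sigma> N, of N] mean_le_best[OF \<sigma> N, of N] N by simp
  have conc: "prob {\<omega> \<in> space M. \<bar>1 / real s * (\<Sum>t=1..s. X n t \<omega>) - mean f n\<bar> \<ge> \<delta>}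
      \<le> 2 * exp (- a * \<delta>\<^sup>2 * real s)" if "n \<in> {1..N}" "s \<ge> 1" for n s
    using assms(7)[OF that, of \<delta>] \<delta> by simp
  let ?l = "\<lambda>t. expectation (\<lambda>\<omega>. mean f (\<sigma> 1) - mean f (played \<pi> t \<omega>))"
  let ?g = "\<lambda>n. mean f (\<sigma> 1) - mean f n"
  have exploit: "?l t \<le> 2 * real N * gap f \<sigma> N * real t powr - p" if t: "2 \<le> t" "t \<notin> A t" for t
  proof -
    \<comment> \<open>The number of complete rounds guaranteed before an exploitation time:
      \<open>t\<close> is not explored only if the threshold has been reached. Since
      \<open>t \<ge> 2\<close>, the logarithm is positive and \<open>L \<ge> 1\<close>.\<close>
    define L where "L = nat \<lceil>w * ln (real t)\<rceil>"
    have pos: "0 < w * ln (real t)" using t w by simp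
    have "int N * \<lceil>w * ln (real t)\<rceil> \<le> int (card (A (t - 1)))"
      using mem[of t] t by simp
    moreover have "\<lceil>w * ln (real t)\<rceil> = int L" using pos by (simp add: L_def)
    ultimately have "int (N * L) \<le> int (card (A (t - 1)))" by (simp only: of_nat_mult)
    then have L: "1 \<le> L" "N * L \<le> card (A (t - 1))" "w * ln (real t) \<le> real L"
      using pos by (simp_all only: of_nat_le_iff) (simp_all add: L_def Suc_le_eq of_nat_ceiling)
    have "exp (- a * \<delta>\<^sup>2 * real L) \<le> exp (- a * \<delta>\<^sup>2 * (w * ln (real t)))"
      using L(3) a by (simp add: mult_left_mono)
    also have "\<dots> = real t powr - p"
      using t by (simp add: p_def powr_def)
    finally have "2 * real N * exp (- a * \<delta>\<^sup>2 * real L) \<le> 2 * real N * real t powr - p"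
      by (intro mult_left_mono) auto
    moreover have "prob {\<omega> \<in> space M. played \<pi> t \<omega> \<noteq> \<sigma> 1} \<le> 2 * real N * exp (- a * \<delta>\<^sup>2 * real L)"
      using t a by (intro prob_suboptimal_le[OF \<pi> A \<sigma> _ _ L(1,2) _ conc \<delta>(3)]) auto
    ultimately have "prob {\<omega> \<in> space M. played \<pi> t \<omega> \<noteq> \<sigma> 1} \<le> 2 * real N * real t powr - p"
      by (rule order_trans[rotated])
    then have "gap f \<sigma> N * prob {\<omega> \<in> space M. played \<pi> t \<omega> \<noteq> \<sigma> 1}
        \<le> gap f \<sigma> N * (2 * real N * real t powr - p)"
      using gap_N by (rule mult_left_mono)
    then show ?thesis using expected_loss_le[OF pol _ \<sigma>, of t] t by (simp add: mult_ac)
  qed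
  \<comment> \<open>No arm has been observed yet at time 1, so the error probability is bounded by
    \<open>1 \<le> 2 * N\<close>. This gives the summand 1 in the final factor.\<close>
  have first: "?l 1 \<le> 2 * real N * gap f \<sigma> N"
  proof -
    have "?l 1 \<le> gap f \<sigma> N * prob {\<omega> \<in> space M. played \<pi> 1 \<omega> \<noteq> \<sigma> 1}"
      by (rule expected_loss_le[OF pol _ \<sigma>]) simp
    also have "\<dots> \<le> gap f \<sigma> N * (2 * real N)"
      using gap_N N by (intro mult_left_mono order_trans[OF prob_le_1]) auto
    finally show ?thesis by (simp add: mult_ac)
  qed
  have AT: "A T \<subseteq> {1..T}" using bij_betw_card_exploration[OF A] by simp
  \<comment> \<open>Being explored is decided at time \<open>t\<close> itself, so \<open>A T\<close>
    alone separates exploration from exploitation up to \<open>T\<close>.\<close>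
  have AT_iff: "t \<in> A T \<longleftrightarrow> t \<in> A t" if "t \<le> T" for t
    using exploration_mem[OF A] exploration_mono[OF A that] by auto
  have "1 \<notin> A T" using AT_iff[of 1] A assms(14) by (simp add: exploration_sequence_def)
  then have AT2: "{1..T} - A T = insert 1 ({2..T} - A T)"
    using assms(14) by auto
  have "regret M f X U \<sigma> \<pi> T = (\<Sum>t\<in>A T. ?l t) + (\<Sum>t\<in>{1..T} - A T. ?l t)"
    unfolding regret_eq[OF pol] using AT by (subst sum.subset_diff[OF AT]) auto
  also have "(\<Sum>t\<in>A T. ?l t) = (\<Sum>t\<in>A T. ?g (card (A t) \<oslash> N))"
  proof (rule sum.cong)
    fix t assume "t \<in> A T"
    then have "1 \<le> t" "t \<in> A t" using AT exploration_mem[OF A] by auto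
    then show "?l t = ?g (card (A t) \<oslash> N)" by (simp add: played_exploration[OF \<pi>] prob_space)
  qed simp
  also have "\<dots> \<le> real (nat \<lceil>w * ln (real T)\<rceil>) * (\<Sum>n=1..N. ?g n)"
  proof (rule sum_exploration_le[OF A])
    have "int (card (A T)) \<le> int N * \<lceil>w * ln (real T)\<rceil>"
      using w by (intro card_exploration_le[OF A _ mem assms(14)]) auto
    also have "\<dots> \<le> int (N * nat \<lceil>w * ln (real T)\<rceil>)" by (simp add: mult_left_mono)
    finally show "card (A T) \<le> N * nat \<lceil>w * ln (real T)\<rceil>" by linarith
  qed (use N mean_le_best[OF \<sigma> N] in auto)
  \<comment> \<open>As \<open>T \<ge> 1\<close>, the ceiling is nonnegative and \<open>nat\<close>
    does not truncate it.\<close>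
  also have "\<dots> = (\<Sum>n=2..N. of_int \<lceil>w * ln (real T)\<rceil> * gap f \<sigma> n)"
    using w assms(14) by (simp only: sum_gap[OF \<sigma> N] sum_distrib_left) simp
  also have "(\<Sum>t\<in>{1..T} - A T. ?l t) = ?l 1 + (\<Sum>t\<in>{2..T} - A T. ?l t)"
    unfolding AT2 by simp
  also have "(\<Sum>t\<in>{2..T} - A T. ?l t) \<le> (\<Sum>t\<in>{2..T} - A T. 2 * real N * gap f \<sigma> N * real t powr - p)"
    using AT_iff by (intro sum_mono exploit) auto
  \<comment> \<open>The exploration times are put back with nonnegative terms, so that the full sum
    of powers can be bounded.\<close>
  also have "\<dots> \<le> (\<Sum>t=2..T. 2 * real N * gap f \<sigma> N * real t powr - p)"
    using gap_N by (intro sum_mono2) auto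
  also have "\<dots> \<le> 2 * real N * gap f \<sigma> N * (1 / (p - 1))"
    unfolding sum_distrib_left[symmetric]
    using gap_N by (intro mult_left_mono sum_powr_le[OF p]) auto
  finally show ?thesis
    using first by (simp add: p_def algebra_simps)
qed

end
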